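(* Let $N>2$, $\alpha_0>0$ and $\alpha_\mu<0$ for $0<\mu<N$. Consider unit vectors $\mathbf{s}_0,\dots,\mathbf{s}_{N-1}\in\mathbb{R}^3$ (indices modulo $N$) with energy $E=\sum_{\mu=0}^{N-1}\alpha_\mu\,\mathbf{s}_\mu\cdot\mathbf{s}_{\mu+1}$. Assume that $$0<\alpha_0<|\alpha_\tau|:=\min_{0<\mu<N}|\alpha_\mu|.$$ Define $$\alpha_{(c)}:=\Big(\sum_{\mu=1}^{N-1}|\alpha_\mu|^{-1}\Big)^{-1}.$$ Then $\alpha_{(c)}<|\alpha_\tau|$, and the lowest energy configuration of the system is collinear if and only if $0<\alpha_0\le\alpha_{(c)}$.
   Context: A lowest energy configuration (LEC) is a configuration of unit vectors in $\mathbb{R}^3$ that globally minimizes $E$. A configuration is collinear if its vectors span a one-dimensional subspace of $\mathbb{R}^3$, and coplanar if they span a two-dimensional subspace; every LEC of this system is either collinear or coplanar. *)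

theory Defs
  imports "HOL-Analysis.Analysis"
begin

text \<open>A configuration is a function on \<open>nat\<close> of which only the values at
  \<open>0, \<dots>, N - 1\<close> matter; everything below depends on those values alone.\<close>

definition spin_config :: "nat \<Rightarrow> (nat \<Rightarrow> real ^ 3) \<Rightarrow> bool" where
  "spin_config N s \<longleftrightarrow> (\<forall>\<mu><N. norm (s \<mu>) = 1)"

definition energy :: "nat \<Rightarrow> (nat \<Rightarrow> real) \<Rightarrow> (nat \<Rightarrow> real ^ 3) \<Rightarrow> real" where
  "energy N \<alpha> s = (\<Sum>\<mu><N. \<alpha> \<mu> * (s \<mu> \<bullet> s ((\<mu> + 1) mod N)))"

definition lowest_energy_config :: "nat \<Rightarrow> (nat \<Rightarrow> real) \<Rightarrow> (nat \<Rightarrow> real ^ 3) \<Rightarrow> bool" where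
  "lowest_energy_config N \<alpha> s \<longleftrightarrow>
     spin_config N s \<and> (\<forall>t. spin_config N t \<longrightarrow> energy N \<alpha> s \<le> energy N \<alpha> t)"

text \<open>Collinearity here refers to the linear span of the vectors. It is not the library's
  \<^const>\<open>collinear\<close>, which asks for the points to lie on a common affine line.\<close>

definition collinear_config :: "nat \<Rightarrow> (nat \<Rightarrow> real ^ 3) \<Rightarrow> bool" where
  "collinear_config N s \<longleftrightarrow> dim (span (s ` {..<N})) = 1"

definition critical_coupling :: "nat \<Rightarrow> (nat \<Rightarrow> real) \<Rightarrow> real" where
  "critical_coupling N \<alpha> = inverse (\<Sum>\<mu>=1..N - 1. inverse \<bar>\<alpha> \<mu>\<bar>)"

end

theory Submission
  imports Defs
begin

text \<open>Since \<open>1 - s\<^sub>\<mu> \<bullet> s\<^sub>\<mu>\<^sub>+\<^sub>1 = |s\<^sub>\<mu>\<^sub>+\<^sub>1 - s\<^sub>\<mu>|\<^sup>2 / 2\<close>, the energy relative to the fully aligned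
  configuration is a quadratic form in the increments \<open>w\<^sub>\<mu> = s\<^sub>\<mu>\<^sub>+\<^sub>1 - s\<^sub>\<mu>\<close>. The increments with
  \<open>\<mu> \<ge> 1\<close> add up to \<open>W = s\<^sub>0 - s\<^sub>1\<close>, and completing the square (\<open>c\<close> the critical coupling) gives
  \<open>2 (E - E\<^sub>a\<^sub>l\<^sub>i\<^sub>g\<^sub>n\<^sub>e\<^sub>d) = (c - \<alpha>\<^sub>0) |W|\<^sup>2 + \<Sum> |\<alpha>\<^sub>\<mu>| |w\<^sub>\<mu> - (c / |\<alpha>\<^sub>\<mu>|) W|\<^sup>2\<close>.
  If \<open>\<alpha>\<^sub>0 \<le> c\<close> this is nonnegative, and it vanishes only if the \<open>N \<ge> 3\<close> spins lie in order on an
  affine line; as a line meets the sphere in at most two points, all spins then coincide.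
  If \<open>\<alpha>\<^sub>0 > c\<close>, the planar spiral with small angle increments proportional to \<open>1 / |\<alpha>\<^sub>\<mu>|\<close> has
  lower energy than the aligned configuration, which is optimal among the collinear ones.\<close>

section \<open>Completing the square, and lines meeting spheres\<close>

lemma sum_weighted_norm_square_decomp:
  fixes w :: "'a \<Rightarrow> 'b :: real_inner" and a :: "'a \<Rightarrow> real"
  assumes "finite A" "A \<noteq> {}" and pos: "\<And>i. i \<in> A \<Longrightarrow> a i > 0"
  defines "c \<equiv> inverse (\<Sum>i\<in>A. inverse (a i))" and "W \<equiv> sum w A"
  shows "(\<Sum>i\<in>A. a i * (norm (w i))\<^sup>2) =
    c * (norm W)\<^sup>2 + (\<Sum>i\<in>A. a i * (norm (w i - (c / a i) *\<^sub>R W))\<^sup>2)"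
proof -
  have S: "(\<Sum>i\<in>A. inverse (a i)) > 0"
    using assms by (intro sum_pos) auto
  have "a i * (norm (w i - (c / a i) *\<^sub>R W))\<^sup>2 =
      a i * (norm (w i))\<^sup>2 - 2 * c * (w i \<bullet> W) + c\<^sup>2 * (norm W)\<^sup>2 * inverse (a i)" if "i \<in> A" for i
  proof -
    have *: "(norm (w i - (c / a i) *\<^sub>R W))\<^sup>2 =
        (norm (w i))\<^sup>2 - 2 * (c / a i) * (w i \<bullet> W) + (c / a i)\<^sup>2 * (norm W)\<^sup>2"
      unfolding power2_norm_eq_inner
      by (simp add: inner_diff_left inner_diff_right inner_commute power2_eq_square algebra_simps)
    show ?thesis
      unfolding * using pos[OF that] by (simp add: field_simps power2_eq_square)
  qed
  \<comment> \<open>The factor \<open>c / a i\<close> cancels the weight in each cross term, so the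
    cross terms add up to a multiple of \<open>W \<bullet> W\<close> alone.\<close>
  then have "(\<Sum>i\<in>A. a i * (norm (w i - (c / a i) *\<^sub>R W))\<^sup>2) =
      (\<Sum>i\<in>A. a i * (norm (w i))\<^sup>2) - 2 * c * (W \<bullet> W) + c\<^sup>2 * (norm W)\<^sup>2 * (\<Sum>i\<in>A. inverse (a i))"
    by (simp add: sum.distrib sum_subtractf sum_distrib_left W_def inner_sum_left)
  also have "c\<^sup>2 * (norm W)\<^sup>2 * (\<Sum>i\<in>A. inverse (a i)) = c * (norm W)\<^sup>2"
    using S by (simp add: c_def power2_eq_square)
  finally show ?thesis
    by (simp add: power2_norm_eq_inner)
qed

text \<open>The difference of the squared norms of \<open>u + z *\<^sub>R W\<close> and
  \<open>u\<close> is \<open>z\<close> times an affine function of \<open>z\<close> with slope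
  \<open>W \<bullet> W\<close>. Two distinct nonzero roots force this slope to vanish.\<close>

lemma eq_0_if_three_equal_norms_on_line:
  fixes u W :: "'a :: real_inner"
  assumes "norm (u + x *\<^sub>R W) = norm u" "norm (u + y *\<^sub>R W) = norm u" "x \<noteq> 0" "y \<noteq> 0" "x \<noteq> y"
  shows "W = 0"
proof -
  have *: "2 * (u \<bullet> W) + z * (W \<bullet> W) = 0" if "norm (u + z *\<^sub>R W) = norm u" "z \<noteq> 0" for z
  proof -
    have "(u + z *\<^sub>R W) \<bullet> (u + z *\<^sub>R W) = u \<bullet> u"
      using that(1) by (simp add: norm_eq)
    then have "z * (2 * (u \<bullet> W) + z * (W \<bullet> W)) = 0"
      by (simp add: inner_add_left inner_add_right inner_commute algebra_simps)
    then show ?thesis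
      using that(2) by simp
  qed
  have "x * (W \<bullet> W) = y * (W \<bullet> W)"
    using *[of x] *[of y] assms by linarith
  then show ?thesis
    using assms by simp
qed

section \<open>Energy and increments around the ring\<close>

lemma lessThan_eq_insert_0: "0 < N \<Longrightarrow> {..<N} = insert 0 {1..<N}" for N :: nat
  by auto

lemma critical_coupling_eq:
  "critical_coupling N \<alpha> = inverse (\<Sum>\<mu>\<in>{1..<N}. inverse \<bar>\<alpha> \<mu>\<bar>)"
proof -
  have "{1..N - 1} = {1..<N}" by auto
  then show ?thesis by (simp add: critical_coupling_def)
qed

lemma energy_eq_norm_increments:
  assumes "spin_config N s" "0 < N"
  shows "energy N \<alpha> s =
    sum \<alpha> {..<N} - (\<Sum>\<mu><N. \<alpha> \<mu> * (norm (s ((\<mu> + 1) mod N) - s \<mu>))\<^sup>2) / 2"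
proof -
  have "\<alpha> \<mu> * (s \<mu> \<bullet> s ((\<mu> + 1) mod N)) =
      \<alpha> \<mu> - \<alpha> \<mu> * (norm (s ((\<mu> + 1) mod N) - s \<mu>))\<^sup>2 / 2" if "\<mu> < N" for \<mu>
  proof -
    have "norm (s \<mu>) = 1" "norm (s ((\<mu> + 1) mod N)) = 1"
      using assms that unfolding spin_config_def by auto
    then have "s \<mu> \<bullet> s \<mu> = 1" "s ((\<mu> + 1) mod N) \<bullet> s ((\<mu> + 1) mod N) = 1"
      by (simp_all only: norm_eq_1)
    then show ?thesis
      by (simp add: power2_norm_eq_inner inner_diff_left inner_diff_right inner_commute
          field_simps)
  qed
  then show ?thesis
    unfolding energy_def by (simp add: sum_subtractf sum_divide_distrib)
qed

lemma sum_increments: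
  fixes s :: "nat \<Rightarrow> 'a :: real_vector"
  assumes "1 < N"
  shows "(\<Sum>\<mu>\<in>{1..<N}. s ((\<mu> + 1) mod N) - s \<mu>) = s 0 - s 1"
proof -
  \<comment> \<open>Writing \<open>s \<mu>\<close> as \<open>s (\<mu> mod N)\<close> makes the
    closing bond an ordinary term of a telescoping sum.\<close>
  have "(\<Sum>\<mu>\<in>{1..<N}. s ((\<mu> + 1) mod N) - s \<mu>) =
      (\<Sum>\<mu>\<in>{1..<N}. s (Suc \<mu> mod N) - s (\<mu> mod N))"
    by (intro sum.cong) auto
  also have "\<dots> = s (N mod N) - s (1 mod N)"
    by (rule sum_Suc_diff') (use assms in auto)
  finally show ?thesis using assms by simp
qed

lemma energy_constant:
  assumes "norm u = 1"
  shows "energy N \<alpha> (\<lambda>_. u) = sum \<alpha> {..<N}"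
proof -
  have "u \<bullet> u = 1" using assms by (simp add: norm_eq_1)
  then show ?thesis by (simp add: energy_def)
qed

section \<open>Existence of a minimiser\<close>

lemma ex_lowest_energy_config:
  assumes "0 < N"
  shows "\<exists>s. lowest_energy_config N \<alpha> s"
proof -
  \<comment> \<open>The product of spheres over all of \<open>nat\<close> is compact by Tychonoff,
    and the energy is continuous on it, being a finite sum in the coordinates.\<close>
  define K where "K = (PiE UNIV (\<lambda>_. sphere 0 1) :: (nat \<Rightarrow> real ^ 3) set)"
  have "compactin (product_topology (\<lambda>_. euclidean) UNIV) K"
    unfolding K_def by (subst compactin_PiE) auto
  then have "compact K"
    by (simp add: euclidean_product_topology)
  moreover have "(\<lambda>_. axis 1 1) \<in> K"
    by (auto simp: K_def PiE_def extensional_def)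
  then have "K \<noteq> {}" by blast
  moreover have "continuous_on K (\<lambda>s. s \<mu>)" for \<mu>
    by (rule continuous_on_subset[OF continuous_on_product_coordinates]) simp
  then have "continuous_on K (energy N \<alpha>)"
    unfolding energy_def by (intro continuous_intros)
  ultimately obtain s where s: "s \<in> K" "\<And>t. t \<in> K \<Longrightarrow> energy N \<alpha> s \<le> energy N \<alpha> t"
    using continuous_attains_inf[of K "energy N \<alpha>"] by blast
  have "energy N \<alpha> s \<le> energy N \<alpha> t" if t: "spin_config N t" for t
  proof -
    \<comment> \<open>Values of \<open>t\<close> from index \<open>N\<close> on need not be unit
      vectors; the periodic extension lies in \<open>K\<close> and has the same energy.\<close>
    define t' where "t' = (\<lambda>\<mu>. t (\<mu> mod N))"
    have "t' \<in> K"
      using t assms by (auto simp: K_def t'_def spin_config_def)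
    moreover have "energy N \<alpha> t' = energy N \<alpha> t"
      unfolding energy_def t'_def by (intro sum.cong) auto
    ultimately show ?thesis using s(2) by metis
  qed
  moreover have "spin_config N s"
    using s(1) by (auto simp: K_def spin_config_def PiE_def Pi_def)
  ultimately show ?thesis
    unfolding lowest_energy_config_def by blast
qed

section \<open>Collinear configurations\<close>

lemma collinear_config_constant:
  assumes "0 < N" "norm (s 0) = 1" "\<And>\<mu>. \<mu> < N \<Longrightarrow> s \<mu> = s 0"
  shows "collinear_config N s"
proof -
  have "s ` {..<N} = (\<lambda>_. s 0) ` {..<N}"
    by (intro image_cong refl assms(3)) simp
  also have "\<dots> = {s 0}"
    using assms(1) by auto
  finally have "s ` {..<N} = {s 0}" .
  moreover have "s 0 \<noteq> 0" using assms(2) by auto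
  ultimately show ?thesis
    unfolding collinear_config_def by (simp add: dim_span)
qed

text \<open>A single spin is nonzero and so already generates the one-dimensional span; unit length
  leaves only the factors 1 and -1.\<close>

lemma collinear_config_cases:
  assumes "collinear_config N s" "spin_config N s" "\<mu> < N" "\<nu> < N"
  shows "s \<mu> = s \<nu> \<or> s \<mu> = - s \<nu>"
proof -
  have n: "norm (s \<mu>) = 1" "norm (s \<nu>) = 1"
    using assms unfolding spin_config_def by auto
  then have "s \<nu> \<noteq> 0" by auto
  have "s ` {..<N} \<subseteq> span {s \<nu>}"
  proof (rule card_ge_dim_independent)
    show "{s \<nu>} \<subseteq> s ` {..<N}" using assms by auto
    show "independent {s \<nu>}" using \<open>s \<nu> \<noteq> 0\<close> by simp
    show "dim (s ` {..<N}) \<le> card {s \<nu>}"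
      using assms(1) by (simp add: collinear_config_def dim_span)
  qed
  then obtain k where k: "s \<mu> = k *\<^sub>R s \<nu>"
    using assms(3) by (auto simp: span_singleton)
  then have "\<bar>k\<bar> = 1" using n by simp
  then show ?thesis using k by (auto simp: abs_if split: if_splits)
qed

section \<open>Estimates of the cosine, and spins in a plane\<close>

lemma ex_small_cos_gap:
  fixes a c :: real
  assumes "0 < c" "c < a"
  shows "\<exists>x. c * x\<^sup>2 / 2 < a * (1 - cos x)"
proof -
  \<comment> \<open>With \<open>x = 2 * y\<close>, the quotient of \<open>1 - cos x\<close> by
    \<open>x\<^sup>2 / 2\<close> is \<open>(sin y / y)\<^sup>2\<close>. It tends to 1 and thus
    eventually exceeds \<open>c / a\<close>.\<close>
  have "((\<lambda>y::real. sin y / y) \<longlongrightarrow> 1) (at_right 0)"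
    using DERIV_sin[of "0::real"] by (simp add: has_field_derivative_iff at_within_union filterlim_at_split)
  then have "((\<lambda>y::real. (sin y / y)\<^sup>2) \<longlongrightarrow> 1\<^sup>2) (at_right 0)"
    by (rule tendsto_power)
  moreover have "c / a < 1\<^sup>2" using assms by simp
  ultimately have "\<forall>\<^sub>F y in at_right 0. c / a < (sin y / y)\<^sup>2"
    by (rule order_tendstoD)
  moreover have "\<forall>\<^sub>F y in at_right (0::real). 0 < y"
    by (simp add: eventually_at_right_less)
  ultimately have "\<forall>\<^sub>F y in at_right 0. 0 < y \<and> c / a < (sin y / y)\<^sup>2"
    by eventually_elim simp
  then obtain y :: real where "0 < y" "c / a < (sin y / y)\<^sup>2"
    using eventually_happens' trivial_limit_at_right_real by blast
  moreover have *: "1 - cos (2 * y) = 2 * (sin y)\<^sup>2"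
    unfolding cos_double_sin by simp
  ultimately have "c * (2 * y)\<^sup>2 / 2 < a * (1 - cos (2 * y))"
    unfolding * using assms by (simp add: field_simps)
  then show ?thesis ..
qed

definition planar_spin :: "real \<Rightarrow> real ^ 3" where
  "planar_spin \<theta> = vector [cos \<theta>, sin \<theta>, 0]"

lemma inner_planar_spin: "planar_spin x \<bullet> planar_spin y = cos (y - x)"
  by (simp add: planar_spin_def inner_vec_def sum_3 cos_diff)

lemma norm_planar_spin: "norm (planar_spin x) = 1"
  by (simp add: norm_eq_1 inner_planar_spin)

lemma one_minus_cos_le: "1 - cos x \<le> x\<^sup>2 / 2" for x :: real
proof -
  have "cos x = 1 - 2 * (sin (x / 2))\<^sup>2"
    using cos_double_sin[of "x / 2"] by simp
  moreover have "(sin (x / 2))\<^sup>2 \<le> (x / 2)\<^sup>2"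
    using abs_sin_x_le_abs_x[of "x / 2"] by (simp only: abs_le_square_iff)
  ultimately show ?thesis by (simp add: power2_eq_square)
qed

section \<open>The ring with one positive coupling\<close>

locale single_antiferromagnetic_bond =
  fixes N :: nat and \<alpha> :: "nat \<Rightarrow> real"
  assumes N: "2 < N" and pos: "0 < \<alpha> 0" and neg: "\<And>\<mu>. 0 < \<mu> \<Longrightarrow> \<mu> < N \<Longrightarrow> \<alpha> \<mu> < 0"
begin

abbreviation increment :: "(nat \<Rightarrow> real ^ 3) \<Rightarrow> nat \<Rightarrow> real ^ 3" where
  "increment s \<mu> \<equiv> s ((\<mu> + 1) mod N) - s \<mu>"

abbreviation "c \<equiv> critical_coupling N \<alpha>"

lemma critical_coupling_pos: "0 < c"
proof -
  have "0 < (\<Sum>\<mu>\<in>{1..<N}. inverse \<bar>\<alpha> \<mu>\<bar>)"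
    using N neg by (intro sum_pos) (auto simp: less_imp_neq)
  then show ?thesis by (simp add: critical_coupling_eq)
qed

lemma critical_coupling_less:
  assumes "0 < \<tau>" "\<tau> < N"
  shows "c < \<bar>\<alpha> \<tau>\<bar>"
proof -
  \<comment> \<open>As \<open>N > 2\<close>, there is a second negative bond; its reciprocal makes
    the sum strictly larger than the one for \<open>\<tau>\<close>.\<close>
  define \<nu> where "\<nu> = (if \<tau> = 1 then 2 else 1 :: nat)"
  have \<nu>: "\<nu> \<noteq> \<tau>" "0 < \<nu>" "\<nu> < N" using N assms by (auto simp: \<nu>_def)
  have "inverse \<bar>\<alpha> \<tau>\<bar> < inverse \<bar>\<alpha> \<tau>\<bar> + inverse \<bar>\<alpha> \<nu>\<bar>"
    using neg[OF \<nu>(2,3)] by simp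
  also have "\<dots> = (\<Sum>\<mu>\<in>{\<tau>, \<nu>}. inverse \<bar>\<alpha> \<mu>\<bar>)"
    using \<nu> by simp
  also have "\<dots> \<le> (\<Sum>\<mu>\<in>{1..<N}. inverse \<bar>\<alpha> \<mu>\<bar>)"
    using assms \<nu> by (intro sum_mono2) auto
  finally have *: "inverse \<bar>\<alpha> \<tau>\<bar> < (\<Sum>\<mu>\<in>{1..<N}. inverse \<bar>\<alpha> \<mu>\<bar>)" .
  have "0 < inverse \<bar>\<alpha> \<tau>\<bar>" using neg[OF assms] by simp
  from less_imp_inverse_less[OF * this] show ?thesis
    by (simp add: critical_coupling_eq)
qed

text \<open>Only bond 0 contributes negatively. Its increment is written as
  \<open>s 0 - s 1\<close>, the total of the other increments, in preparation for completing the
  square.\<close>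

lemma energy_excess:
  assumes "spin_config N s"
  shows "2 * (energy N \<alpha> s - sum \<alpha> {..<N}) =
    (\<Sum>\<mu>\<in>{1..<N}. \<bar>\<alpha> \<mu>\<bar> * (norm (increment s \<mu>))\<^sup>2) - \<alpha> 0 * (norm (s 0 - s 1))\<^sup>2"
proof -
  have "(\<Sum>\<mu><N. \<alpha> \<mu> * (norm (increment s \<mu>))\<^sup>2) =
      \<alpha> 0 * (norm (increment s 0))\<^sup>2 + (\<Sum>\<mu>\<in>{1..<N}. \<alpha> \<mu> * (norm (increment s \<mu>))\<^sup>2)"
    using N by (simp add: lessThan_eq_insert_0)
  also have "increment s 0 = s 1 - s 0" using N by simp
  also have "(\<Sum>\<mu>\<in>{1..<N}. \<alpha> \<mu> * (norm (increment s \<mu>))\<^sup>2) =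
      - (\<Sum>\<mu>\<in>{1..<N}. \<bar>\<alpha> \<mu>\<bar> * (norm (increment s \<mu>))\<^sup>2)"
    unfolding sum_negf[symmetric] by (intro sum.cong) (use neg in \<open>auto simp: abs_of_neg\<close>)
  finally show ?thesis
    using energy_eq_norm_increments[OF assms, of \<alpha>] N
    by (simp add: norm_minus_commute diff_divide_distrib)
qed

lemma energy_excess_squares:
  assumes "spin_config N s"
  shows "2 * (energy N \<alpha> s - sum \<alpha> {..<N}) =
    (c - \<alpha> 0) * (norm (s 0 - s 1))\<^sup>2 +
    (\<Sum>\<mu>\<in>{1..<N}. \<bar>\<alpha> \<mu>\<bar> * (norm (increment s \<mu> - (c / \<bar>\<alpha> \<mu>\<bar>) *\<^sub>R (s 0 - s 1)))\<^sup>2)"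
proof -
  let ?T = "\<Sum>\<mu>\<in>{1..<N}. \<bar>\<alpha> \<mu>\<bar> * (norm (increment s \<mu>))\<^sup>2"
  let ?V = "sum (increment s) {1..<N}"
  have "\<bar>\<alpha> \<mu>\<bar> > 0" if "\<mu> \<in> {1..<N}" for \<mu> using neg[of \<mu>] that by simp
  moreover have "{1..<N} \<noteq> {}" using N by simp
  ultimately have decomp: "?T = c * (norm ?V)\<^sup>2 +
      (\<Sum>\<mu>\<in>{1..<N}. \<bar>\<alpha> \<mu>\<bar> * (norm (increment s \<mu> - (c / \<bar>\<alpha> \<mu>\<bar>) *\<^sub>R ?V))\<^sup>2)"
    unfolding critical_coupling_eq by (intro sum_weighted_norm_square_decomp) auto
  have V: "?V = s 0 - s 1"
    using N by (intro sum_increments) simp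
  show ?thesis
    unfolding energy_excess[OF assms] using decomp unfolding V by (simp only: left_diff_distrib)
qed

lemma constant_if_energy_le:
  assumes s: "spin_config N s" and "\<alpha> 0 \<le> c" and E: "energy N \<alpha> s \<le> sum \<alpha> {..<N}"
    and "\<mu> < N"
  shows "s \<mu> = s 0"
proof -
  define W where "W = s 0 - s 1"
  define k where "k = (\<lambda>\<mu>. c / \<bar>\<alpha> \<mu>\<bar>)"
  let ?f = "\<lambda>\<mu>. \<bar>\<alpha> \<mu>\<bar> * (norm (increment s \<mu> - k \<mu> *\<^sub>R W))\<^sup>2"
  define P where "P = (c - \<alpha> 0) * (norm W)\<^sup>2"
  define T where "T = sum ?f {1..<N}"
  have "T \<ge> 0" unfolding T_def by (intro sum_nonneg) simp
  moreover have "P \<ge> 0" using assms by (simp add: P_def)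
  moreover have "2 * (energy N \<alpha> s - sum \<alpha> {..<N}) = P + T"
    unfolding P_def T_def W_def k_def by (rule energy_excess_squares[OF s])
  ultimately have "T = 0" using E by argo
  then have f0: "?f \<mu> = 0" if "\<mu> \<in> {1..<N}" for \<mu>
    using that unfolding T_def by (subst (asm) sum_nonneg_eq_0_iff) auto
  have inc: "s ((\<mu> + 1) mod N) = s \<mu> + k \<mu> *\<^sub>R W" if "0 < \<mu>" "\<mu> < N" for \<mu>
  proof -
    have "increment s \<mu> - k \<mu> *\<^sub>R W = 0"
      using f0[of \<mu>] that neg[OF that] by simp
    then show ?thesis by (simp add: algebra_simps)
  qed
  have k: "k \<mu> > 0" if "0 < \<mu>" "\<mu> < N" for \<mu>
    unfolding k_def using neg[OF that] critical_coupling_pos by (intro divide_pos_pos) auto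
  have "W = 0"
  \<comment> \<open>The three points are \<open>s 1\<close>, \<open>s 2\<close> and
    \<open>s (3 mod N)\<close>, the last being \<open>s 0\<close> if \<open>N = 3\<close>. Their
    parameters 0, \<open>k 1\<close> and \<open>k 1 + k 2\<close> differ because \<open>k\<close> is
    positive.\<close>
  proof (rule eq_0_if_three_equal_norms_on_line)
    have 2: "s 2 = s 1 + k 1 *\<^sub>R W" using inc[of 1] N by (simp add: numeral_2_eq_2)
    have 3: "s (3 mod N) = s 1 + (k 1 + k 2) *\<^sub>R W"
      using inc[of 2] N 2 by (simp add: numeral_3_eq_3 algebra_simps)
    have "norm (s 1) = 1" "norm (s 2) = 1" "norm (s (3 mod N)) = 1"
      using s N unfolding spin_config_def by auto
    then show "norm (s 1 + k 1 *\<^sub>R W) = norm (s 1)"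
      "norm (s 1 + (k 1 + k 2) *\<^sub>R W) = norm (s 1)"
      using 2 3 by simp_all
    show "k 1 \<noteq> 0" "k 1 + k 2 \<noteq> 0" "k 1 \<noteq> k 1 + k 2"
      using k[of 1] k[of 2] N by simp_all
  qed
  from \<open>\<mu> < N\<close> show ?thesis
  proof (induction \<mu>)
    case (Suc \<mu>)
    show ?case
    \<comment> \<open>\<open>inc\<close> starts at bond 1; across bond 0 the equality is
      \<open>W = 0\<close> itself.\<close>
    proof (cases "\<mu> = 0")
      case True
      then show ?thesis using \<open>W = 0\<close> by (simp add: W_def)
    next
      case False
      then show ?thesis using inc[of \<mu>] Suc \<open>W = 0\<close> by simp
    qed
  qed simp
qed

text \<open>Every increment has norm 0 or 2. If bond 0 is flipped, the other increments have a
  nonzero total, so another bond is flipped too, and by \<open>weak\<close> its cost is at least the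
  gain at bond 0.\<close>

lemma collinear_energy_ge:
  assumes s: "spin_config N s" and "collinear_config N s"
    and weak: "\<And>\<mu>. 0 < \<mu> \<Longrightarrow> \<mu> < N \<Longrightarrow> \<alpha> 0 \<le> \<bar>\<alpha> \<mu>\<bar>"
  shows "sum \<alpha> {..<N} \<le> energy N \<alpha> s"
proof -
  let ?f = "\<lambda>\<mu>. \<bar>\<alpha> \<mu>\<bar> * (norm (increment s \<mu>))\<^sup>2"
  have "\<alpha> 0 * (norm (s 0 - s 1))\<^sup>2 \<le> sum ?f {1..<N}"
  proof (cases "s 0 = s 1")
    case True
    then show ?thesis by (simp add: sum_nonneg)
  next
    case False
    have norm2: "norm (s \<mu> - s \<nu>) = 2" if "s \<mu> \<noteq> s \<nu>" "\<mu> < N" "\<nu> < N" for \<mu> \<nu>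
    proof -
      have "s \<mu> = - s \<nu>" using collinear_config_cases[OF assms(2) s that(2,3)] that(1) by simp
      then have "s \<mu> - s \<nu> = (- 2) *\<^sub>R s \<nu>" by (simp add: scaleR_2)
      then show ?thesis using s that(3) by (simp add: spin_config_def)
    qed
    have "sum (increment s) {1..<N} \<noteq> 0"
      using False N by (subst sum_increments) auto
    then obtain \<nu> where \<nu>: "\<nu> \<in> {1..<N}" "increment s \<nu> \<noteq> 0"
      by (meson sum.not_neutral_contains_not_neutral)
    then have "norm (increment s \<nu>) = 2" "norm (s 0 - s 1) = 2"
      using N False by (auto intro!: norm2)
    then have "\<alpha> 0 * (norm (s 0 - s 1))\<^sup>2 \<le> ?f \<nu>"
      using weak[of \<nu>] \<nu>(1) by simp
    also have "\<dots> \<le> sum ?f {1..<N}"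
      using \<nu>(1) by (intro member_le_sum) auto
    finally show ?thesis .
  qed
  then have "0 \<le> 2 * (energy N \<alpha> s - sum \<alpha> {..<N})"
    by (simp only: energy_excess[OF s] diff_ge_0_iff_ge)
  then show ?thesis by simp
qed

section \<open>The spiral beyond the critical coupling\<close>

lemma ex_energy_less:
  assumes "c < \<alpha> 0"
  shows "\<exists>t. spin_config N t \<and> energy N \<alpha> t < sum \<alpha> {..<N}"
proof -
  obtain x where x: "c * x\<^sup>2 / 2 < \<alpha> 0 * (1 - cos x)"
    using ex_small_cos_gap[OF critical_coupling_pos assms] by blast
  \<comment> \<open>The factor \<open>c\<close> normalises the angles of the bonds from 1 to
    \<open>N - 1\<close> to the total \<open>x\<close>.\<close>
  define \<delta> where "\<delta> = (\<lambda>\<mu>. x * c / \<bar>\<alpha> \<mu>\<bar>)"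
  define \<theta> where "\<theta> = (\<lambda>\<mu>. \<Sum>\<nu>\<in>{1..<\<mu>}. \<delta> \<nu>)"
  \<comment> \<open>Spin 0 gets the angle \<open>\<theta> N\<close>, as it ends the chain that
    starts at spin 1 with angle 0. Bond 0 therefore spans the whole angle \<open>x\<close>.\<close>
  define t where "t = (\<lambda>\<mu>. planar_spin (if \<mu> = 0 then \<theta> N else \<theta> \<mu>))"
  have c: "c * (\<Sum>\<mu>\<in>{1..<N}. inverse \<bar>\<alpha> \<mu>\<bar>) = 1"
    using critical_coupling_pos unfolding critical_coupling_eq by simp
  have t: "spin_config N t"
    by (simp add: spin_config_def t_def norm_planar_spin)
  have "\<theta> N = x * (c * (\<Sum>\<mu>\<in>{1..<N}. inverse \<bar>\<alpha> \<mu>\<bar>))"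
    by (simp add: \<theta>_def \<delta>_def sum_distrib_left divide_inverse mult.assoc)
  then have \<theta>N: "\<theta> N = x" unfolding c by simp
  have "t \<mu> \<bullet> t ((\<mu> + 1) mod N) = cos (\<delta> \<mu>)" if "0 < \<mu>" "\<mu> < N" for \<mu>
  proof -
    have "t ((\<mu> + 1) mod N) = planar_spin (\<theta> (Suc \<mu>))"
      using that by (cases "Suc \<mu> = N") (auto simp: t_def)
    moreover have "\<theta> (Suc \<mu>) = \<theta> \<mu> + \<delta> \<mu>"
      using that by (simp add: \<theta>_def)
    ultimately show ?thesis
      using that by (simp add: t_def inner_planar_spin)
  qed
  moreover have "t 0 \<bullet> t ((0 + 1) mod N) = cos x"
    using N \<theta>N by (simp add: t_def inner_planar_spin \<theta>_def)
  ultimately have E: "energy N \<alpha> t = \<alpha> 0 * cos x + (\<Sum>\<mu>\<in>{1..<N}. \<alpha> \<mu> * cos (\<delta> \<mu>))"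
    using N unfolding energy_def by (simp add: lessThan_eq_insert_0)
  \<comment> \<open>Compared with alignment, these bonds together lose at most
    \<open>c * x\<^sup>2 / 2\<close>, which is less than the gain
    \<open>\<alpha> 0 * (1 - cos x)\<close> at bond 0.\<close>
  have "(\<Sum>\<mu>\<in>{1..<N}. \<alpha> \<mu> * cos (\<delta> \<mu>)) \<le>
      (\<Sum>\<mu>\<in>{1..<N}. \<alpha> \<mu> + (c * x\<^sup>2 / 2) * (c * inverse \<bar>\<alpha> \<mu>\<bar>))"
  proof (rule sum_mono)
    fix \<mu> assume "\<mu> \<in> {1..<N}"
    then have a: "\<alpha> \<mu> < 0" using neg[of \<mu>] by simp
    have "(- \<alpha> \<mu>) * (1 - cos (\<delta> \<mu>)) \<le> (- \<alpha> \<mu>) * ((\<delta> \<mu>)\<^sup>2 / 2)"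
      using a by (intro mult_left_mono one_minus_cos_le) simp
    also have "\<dots> = (c * x\<^sup>2 / 2) * (c * inverse \<bar>\<alpha> \<mu>\<bar>)"
      using a by (simp add: \<delta>_def field_simps power2_eq_square)
    finally show "\<alpha> \<mu> * cos (\<delta> \<mu>) \<le> \<alpha> \<mu> + (c * x\<^sup>2 / 2) * (c * inverse \<bar>\<alpha> \<mu>\<bar>)"
      by (simp add: algebra_simps)
  qed
  also have "\<dots> = (\<Sum>\<mu>\<in>{1..<N}. \<alpha> \<mu>) + c * x\<^sup>2 / 2"
    by (simp only: sum.distrib sum_distrib_left[symmetric] c mult_1_right)
  finally have "energy N \<alpha> t < \<alpha> 0 + (\<Sum>\<mu>\<in>{1..<N}. \<alpha> \<mu>)"
    using E x by (simp add: right_diff_distrib)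
  also have "\<dots> = sum \<alpha> {..<N}"
    using N by (simp add: lessThan_eq_insert_0)
  finally show ?thesis using t by blast
qed

text \<open>If \<open>c < \<alpha> 0\<close>, the spiral undercuts every collinear configuration. If
  \<open>\<alpha> 0 \<le> c\<close>, comparison with an aligned configuration shows that the
  minimiser is constant.\<close>

lemma collinear_lowest_energy_config_iff:
  assumes "lowest_energy_config N \<alpha> s"
    and weak: "\<And>\<mu>. 0 < \<mu> \<Longrightarrow> \<mu> < N \<Longrightarrow> \<alpha> 0 \<le> \<bar>\<alpha> \<mu>\<bar>"
  shows "collinear_config N s \<longleftrightarrow> \<alpha> 0 \<le> c"
proof
  have s: "spin_config N s" and min: "\<And>t. spin_config N t \<Longrightarrow> energy N \<alpha> s \<le> energy N \<alpha> t"
    using assms(1) by (auto simp: lowest_energy_config_def)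
  show "\<alpha> 0 \<le> c" if "collinear_config N s"
    using ex_energy_less collinear_energy_ge[OF s that weak] min by (meson not_le order_trans)
  show "collinear_config N s" if "\<alpha> 0 \<le> c"
  proof (rule collinear_config_constant)
    have "energy N \<alpha> s \<le> sum \<alpha> {..<N}"
      using min[of "\<lambda>_. planar_spin 0"]
      by (simp add: energy_constant norm_planar_spin spin_config_def)
    then show "s \<mu> = s 0" if "\<mu> < N" for \<mu>
      using constant_if_energy_le[OF s \<open>\<alpha> 0 \<le> c\<close>] that by blast
    show "0 < N" "norm (s 0) = 1" using N s by (auto simp: spin_config_def)
  qed
qed

end

theorem theorem2:
  fixes N \<tau> :: nat and \<alpha> :: "nat \<Rightarrow> real"
  assumes "N > 2"
    and "\<alpha> 0 > 0"
    and "\<And>\<mu>. 0 < \<mu> \<Longrightarrow> \<mu> < N \<Longrightarrow> \<alpha> \<mu> < 0"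
    and "0 < \<tau>" and "\<tau> < N"
    and "\<bar>\<alpha> \<tau>\<bar> = Min ((\<lambda>\<mu>. \<bar>\<alpha> \<mu>\<bar>) ` {0<..<N})"
    and "\<alpha> 0 < \<bar>\<alpha> \<tau>\<bar>"
  shows "critical_coupling N \<alpha> < \<bar>\<alpha> \<tau>\<bar> \<and>
         (\<exists>s. lowest_energy_config N \<alpha> s) \<and>
         (\<forall>s. lowest_energy_config N \<alpha> s \<longrightarrow>
            (collinear_config N s \<longleftrightarrow> 0 < \<alpha> 0 \<and> \<alpha> 0 \<le> critical_coupling N \<alpha>))"
proof -
  interpret single_antiferromagnetic_bond N \<alpha>
    using assms by unfold_locales auto
  have "\<alpha> 0 \<le> \<bar>\<alpha> \<mu>\<bar>" if "0 < \<mu>" "\<mu> < N" for \<mu>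
  proof -
    have "\<bar>\<alpha> \<tau>\<bar> \<le> \<bar>\<alpha> \<mu>\<bar>" unfolding assms(6) using that by (intro Min_le) auto
    then show ?thesis using assms(7) by simp
  qed
  then show ?thesis
    using critical_coupling_less[OF assms(4,5)] ex_lowest_energy_config[of N \<alpha>]
      collinear_lowest_energy_config_iff assms(1,2) by auto
qed

end
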